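(* Let $0<\alpha<1$ and $h>0$. Let $\chi^0\in L^\infty(\Omega;\{0,1\})$, and let $w^n$, $n\ge 1$, be the pre-threshold fields and $\bar\chi^{\,n-1}$ the L1 history averages of the fractional Helmholtz-threshold scheme started at $\chi^0$. Then, for every $n\ge 1$, $$0\le\bar\chi^{\,n-1}\le 1\qquad\text{and}\qquad 0\le w^n\le 1\quad\text{a.e. in }\Omega .$$ Moreover, if $(\chi^k)_{k=0}^{n-1}$ and $(\widetilde\chi^k)_{k=0}^{n-1}$ are two histories in $L^\infty(\Omega;\{0,1\})$ with $\chi^k\le\widetilde\chi^k$ a.e. for all $k\le n-1$, then the corresponding history averages $\bar\chi^{\,n-1},\bar{\widetilde\chi}^{\,n-1}$ and the corresponding diffused fields $w^n,\widetilde w^n$ (the solutions of the Helmholtz diffusion step with these history averages as data) satisfy $$\bar\chi^{\,n-1}\le\bar{\widetilde\chi}^{\,n-1},\qquad w^n\le\widetilde w^n\quad\text{a.e. in }\Omega .$$ Consequently, thresholding at level $1/2$ preserves this order: $\mathbf 1_{\{w^n>1/2\}}\le\mathbf 1_{\{\widetilde w^n>1/2\}}$ a.e. in $\Omega$.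
   Context: $\Omega=[0,\Lambda)^d\cong\mathbb{T}^d$ is the flat torus with periodic boundary conditions; functions are real-valued. $\Gamma$ is the Gamma function. L1 weights: $b_k:=(k+1)^{1-\alpha}-k^{1-\alpha}$ for $k\ge 0$. L1 history average of $(\chi^k)_{k=0}^{n-1}$: $$\bar\chi^{\,n-1}:=\sum_{j=1}^{n-1}(b_{j-1}-b_j)\,\chi^{n-j}+b_{n-1}\chi^0 .$$ Helmholtz diffusion step: the field $w^n\in H^1(\Omega)$ corresponding to a history $(\chi^k)_{k=0}^{n-1}$ is the weak solution, with periodic boundary conditions, of $$\Big(\frac{1}{\Gamma(2-\alpha)h^\alpha}I-\Delta\Big)w^n=\frac{1}{\Gamma(2-\alpha)h^\alpha}\,\bar\chi^{\,n-1}.$$ Fractional Helmholtz-threshold scheme: start from $\chi^0\in L^\infty(\Omega;\{0,1\})$. For $n\ge1$, given $\chi^0,\dots,\chi^{n-1}$, let $w^n$ be given by the diffusion step and set $\chi^n:=\mathbf 1_{\{w^n>1/2\}}$. *)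

theory Defs
  imports "HOL-Analysis.Analysis"
begin

text \<open>
  The flat torus of side length \<open>\<Lambda>\<close> is represented by its fundamental cell \<open>[0,\<Lambda>)\<^sup>d\<close>, where
  \<open>d = CARD('n)\<close>. A function on the torus is a function on \<open>real^'n\<close> of which only the values
  on the cell matter; periodicity is imposed on the smooth test functions defining the weak
  derivative, which makes the Sobolev space below \<open>H\<^sup>1\<close> of the torus and not of the open cube.
\<close>

definition torus_cell :: "real \<Rightarrow> (real^'n) set" where
  "torus_cell \<Lambda> = {x. \<forall>i. 0 \<le> x $ i \<and> x $ i < \<Lambda>}"

abbreviation torus_measure :: "real \<Rightarrow> (real^'n) measure" where
  "torus_measure \<Lambda> \<equiv> lebesgue_on (torus_cell \<Lambda>)"

definition in_L2 :: "real \<Rightarrow> (real^'n \<Rightarrow> real) \<Rightarrow> bool" where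
  "in_L2 \<Lambda> u \<longleftrightarrow> u \<in> borel_measurable (torus_measure \<Lambda>) \<and>
     integrable (torus_measure \<Lambda>) (\<lambda>x. (u x)\<^sup>2)"

definition in_Linf_01 :: "real \<Rightarrow> (real^'n \<Rightarrow> real) \<Rightarrow> bool" where
  "in_Linf_01 \<Lambda> u \<longleftrightarrow> u \<in> borel_measurable (torus_measure \<Lambda>) \<and>
     (AE x in torus_measure \<Lambda>. u x \<in> {0, 1})"

definition partial_deriv :: "'n \<Rightarrow> (real^'n \<Rightarrow> real) \<Rightarrow> real^'n \<Rightarrow> real" where
  "partial_deriv i f x = frechet_derivative f (at x) (axis i 1)"

text \<open>\<open>C\<^sup>\<infinity>\<close>: all iterated partial derivatives are (Frechet) differentiable everywhere, and
  hence continuous.\<close>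

definition C_infinity :: "(real^'n \<Rightarrow> real) \<Rightarrow> bool" where
  "C_infinity f \<longleftrightarrow> (\<forall>is x. foldr partial_deriv is f differentiable (at x))"

definition periodic :: "real \<Rightarrow> (real^'n \<Rightarrow> real) \<Rightarrow> bool" where
  "periodic \<Lambda> f \<longleftrightarrow> (\<forall>x i. f (x + axis i \<Lambda>) = f x)"

text \<open>\<open>u \<in> H\<^sup>1\<close> of the torus, with weak gradient \<open>G\<close>.\<close>

definition H1_with_gradient ::
  "real \<Rightarrow> (real^'n \<Rightarrow> real) \<Rightarrow> (real^'n \<Rightarrow> real^'n) \<Rightarrow> bool" where
  "H1_with_gradient \<Lambda> u G \<longleftrightarrow>
     in_L2 \<Lambda> u \<and>
     (\<forall>i. in_L2 \<Lambda> (\<lambda>x. G x $ i) \<and>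
       (\<forall>\<phi>. C_infinity \<phi> \<and> periodic \<Lambda> \<phi> \<longrightarrow>
         (\<integral>x. u x * partial_deriv i \<phi> x \<partial>torus_measure \<Lambda>) =
         - (\<integral>x. G x $ i * \<phi> x \<partial>torus_measure \<Lambda>)))"

text \<open>\<open>w \<in> H\<^sup>1\<close> is a weak solution of \<open>(c I - \<Delta>) w = c f\<close> on the torus. The weak gradient is unique
  up to null sets, so it is immaterial which one is chosen.\<close>

definition helmholtz_weak_solution ::
  "real \<Rightarrow> real \<Rightarrow> (real^'n \<Rightarrow> real) \<Rightarrow> (real^'n \<Rightarrow> real) \<Rightarrow> bool" where
  "helmholtz_weak_solution \<Lambda> c f w \<longleftrightarrow>
     (\<exists>G. H1_with_gradient \<Lambda> w G \<and>
       (\<forall>\<phi> H. H1_with_gradient \<Lambda> \<phi> H \<longrightarrow>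
         c * (\<integral>x. w x * \<phi> x \<partial>torus_measure \<Lambda>) + (\<integral>x. G x \<bullet> H x \<partial>torus_measure \<Lambda>) =
         c * (\<integral>x. f x * \<phi> x \<partial>torus_measure \<Lambda>)))"

definition L1_weight :: "real \<Rightarrow> nat \<Rightarrow> real" where
  "L1_weight \<alpha> k = (real k + 1) powr (1 - \<alpha>) - real k powr (1 - \<alpha>)"

text \<open>For \<open>n \<ge> 1\<close>, the average of \<open>chi 0, \<dots>, chi (n - 1)\<close>; its superscript in the
  literature is \<open>n - 1\<close>.\<close>

definition L1_average :: "real \<Rightarrow> (nat \<Rightarrow> real^'n \<Rightarrow> real) \<Rightarrow> nat \<Rightarrow> real^'n \<Rightarrow> real" where
  "L1_average \<alpha> chi n x =
     (\<Sum>j = 1..n-1. (L1_weight \<alpha> (j - 1) - L1_weight \<alpha> j) * chi (n - j) x)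
       + L1_weight \<alpha> (n - 1) * chi 0 x"

definition diffusion_step ::
  "real \<Rightarrow> real \<Rightarrow> real \<Rightarrow> (nat \<Rightarrow> real^'n \<Rightarrow> real) \<Rightarrow> nat \<Rightarrow> (real^'n \<Rightarrow> real) \<Rightarrow> bool" where
  "diffusion_step \<alpha> h \<Lambda> chi n w \<longleftrightarrow>
     helmholtz_weak_solution \<Lambda> (1 / (Gamma (2 - \<alpha>) * h powr \<alpha>)) (L1_average \<alpha> chi n) w"

definition threshold :: "(real^'n \<Rightarrow> real) \<Rightarrow> real^'n \<Rightarrow> real" where
  "threshold w = indicator {x. w x > 1/2}"

text \<open>The phases \<open>chi n\<close> and the fields \<open>w n\<close> are representatives of classes modulo null sets, so
  the update holds almost everywhere. The value \<open>w 0\<close> is not constrained.\<close>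

definition threshold_scheme ::
  "real \<Rightarrow> real \<Rightarrow> real \<Rightarrow> (nat \<Rightarrow> real^'n \<Rightarrow> real) \<Rightarrow> (nat \<Rightarrow> real^'n \<Rightarrow> real) \<Rightarrow> bool" where
  "threshold_scheme \<alpha> h \<Lambda> chi w \<longleftrightarrow>
     in_Linf_01 \<Lambda> (chi 0) \<and>
     (\<forall>n\<ge>1. diffusion_step \<alpha> h \<Lambda> chi n (w n) \<and>
            (AE x in torus_measure \<Lambda>. chi n x = threshold (w n) x))"

end

theory Submission
  imports Defs
begin

text \<open>
  The maximum principle is obtained by duality instead of testing with the negative part of the
  solution, so no chain rule for weak derivatives is needed. For a trigonometric polynomial
  \<open>\<psi> \<ge> 0\<close> the equation \<open>c \<phi> - \<Delta>\<phi> = \<psi>\<close> is solved by a trigonometric polynomial \<open>\<phi>\<close>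
  (divide each coefficient by \<open>c + |k|\<^sup>2\<close>), and \<open>\<phi> \<ge> 0\<close> because \<open>\<Delta>\<phi> \<ge> 0\<close> at a minimum of
  \<open>\<phi>\<close>. Testing the weak formulation with \<open>\<phi>\<close> gives \<open>\<integral> w \<psi> = c \<integral> f \<phi>\<close>, so the moments of \<open>w\<close>
  against nonnegative trigonometric polynomials inherit sign and order from \<open>f\<close>. By
  Stone-Weierstrass on the image of the torus in Euclidean space, these moments determine the sign
  of an integrable function almost everywhere. The L1 weights are nonnegative and telescope to
  1, so the history average is a convex combination of the history.
\<close>

section \<open>Trigonometric polynomials on the torus\<close>

lemma partial_deriv_eqI:
  assumes "(f has_derivative f') (at x)"
  shows "partial_deriv i f x = f' (axis i 1)"
  unfolding partial_deriv_def using frechet_derivative_at[OF assms] by simp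

lemma partial_deriv_add:
  assumes "f differentiable (at x)" "g differentiable (at x)"
  shows "partial_deriv i (\<lambda>x. f x + g x) x = partial_deriv i f x + partial_deriv i g x"
  using partial_deriv_eqI[OF has_derivative_add[OF assms[unfolded frechet_derivative_works]]]
  by (simp add: partial_deriv_def)

lemma partial_deriv_mult:
  assumes "f differentiable (at x)" "g differentiable (at x)"
  shows "partial_deriv i (\<lambda>x. f x * g x) x = f x * partial_deriv i g x + partial_deriv i f x * g x"
  using partial_deriv_eqI[OF has_derivative_mult[OF assms[unfolded frechet_derivative_works]]]
  by (simp add: partial_deriv_def)

text \<open>Chain rule along a line parallel to a coordinate axis. It turns statements about
  \<open>partial_deriv\<close> into one-variable calculus, both for differentiating under the
  integral and for the second-derivative test.\<close>

lemma has_real_derivative_along_axis: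
  fixes f :: "real^'n \<Rightarrow> real"
  assumes "f differentiable (at (x + t *\<^sub>R axis i 1))"
  shows "((\<lambda>t. f (x + t *\<^sub>R axis i 1)) has_real_derivative partial_deriv i f (x + t *\<^sub>R axis i 1)) (at t)"
proof -
  let ?D = "frechet_derivative f (at (x + t *\<^sub>R axis i 1))"
  have f: "(f has_derivative ?D) (at (x + t *\<^sub>R axis i 1))"
    using assms frechet_derivative_works by blast
  have "((\<lambda>t. x + t *\<^sub>R axis i 1) has_derivative (\<lambda>s. s *\<^sub>R axis i 1)) (at t)"
    by (auto intro!: derivative_eq_intros)
  from has_derivative_compose[OF this f]
  have "((\<lambda>t. f (x + t *\<^sub>R axis i 1)) has_derivative (\<lambda>s. ?D (s *\<^sub>R axis i 1))) (at t)" .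
  moreover have "?D (s *\<^sub>R axis i 1) = s * ?D (axis i 1)" for s
    using linear_scale[OF has_derivative_linear[OF f]] by simp
  ultimately show ?thesis
    by (simp add: has_field_derivative_def partial_deriv_def mult.commute[of _ "?D (axis i 1)"] fun_eq_iff)
qed

text \<open>The wave vectors of the torus: for \<Lambda> > 0 this is 2 pi / \<Lambda> times the
  integer lattice, exactly the \<open>k\<close> whose plane waves have period \<Lambda> in every
  coordinate.\<close>

definition dual_lattice :: "real \<Rightarrow> (real^'n) set" where
  "dual_lattice \<Lambda> = {k. \<forall>i. \<exists>m::int. k $ i * \<Lambda> = 2 * pi * m}"

text \<open>The free phase \<open>b\<close> covers sines and constants as well as cosines, so a
  single kind of generator suffices. The inductive form reduces linear statements to one wave,
  without any choice of a canonical list of coefficients.\<close>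

inductive trig_poly :: "real \<Rightarrow> (real^'n \<Rightarrow> real) \<Rightarrow> bool" for \<Lambda> where
  wave: "k \<in> dual_lattice \<Lambda> \<Longrightarrow> trig_poly \<Lambda> (\<lambda>x. a * cos (k \<bullet> x + b))"
| add: "trig_poly \<Lambda> f \<Longrightarrow> trig_poly \<Lambda> g \<Longrightarrow> trig_poly \<Lambda> (\<lambda>x. f x + g x)"

lemma dual_lattice_0 [simp]: "0 \<in> dual_lattice \<Lambda>"
  by (auto simp: dual_lattice_def intro!: exI[of _ 0])

lemma dual_lattice_add: "k \<in> dual_lattice \<Lambda> \<Longrightarrow> l \<in> dual_lattice \<Lambda> \<Longrightarrow> k + l \<in> dual_lattice \<Lambda>"
  unfolding dual_lattice_def mem_Collect_eq
  by (metis (no_types, opaque_lifting) distrib_left distrib_right of_int_add vector_add_component)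

lemma dual_lattice_minus: "k \<in> dual_lattice \<Lambda> \<Longrightarrow> - k \<in> dual_lattice \<Lambda>"
  unfolding dual_lattice_def mem_Collect_eq
  by (metis (no_types, opaque_lifting) mult_minus_left mult_minus_right of_int_minus vector_uminus_component)

lemma dual_lattice_axis: "\<Lambda> \<noteq> 0 \<Longrightarrow> axis i (2 * pi / \<Lambda>) \<in> dual_lattice \<Lambda>"
  unfolding dual_lattice_def mem_Collect_eq
proof
  fix j assume "\<Lambda> \<noteq> 0"
  then show "\<exists>m::int. axis i (2 * pi / \<Lambda>) $ j * \<Lambda> = 2 * pi * m"
    by (cases "i = j") (auto simp: axis_def intro: exI[of _ 1] exI[of _ 0])
qed

lemma trig_poly_const: "trig_poly \<Lambda> (\<lambda>x. c)"
  using trig_poly.wave[of 0 \<Lambda> c 0] by simp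

text \<open>The product-to-sum formula writes a product of two cosines as half the sum of cosines of
  the difference and of the sum of the angles; the new wave vectors \<open>l + - k\<close> and
  \<open>l + k\<close> stay in the lattice.\<close>

lemma trig_poly_wave_mult:
  assumes "trig_poly \<Lambda> f" "k \<in> dual_lattice \<Lambda>"
  shows "trig_poly \<Lambda> (\<lambda>x. f x * (a * cos (k \<bullet> x + b)))"
  using assms(1)
proof induction
  case (wave l a' b')
  have "(\<lambda>x. a' * cos (l \<bullet> x + b') * (a * cos (k \<bullet> x + b))) =
    (\<lambda>x. a * a' / 2 * cos ((l + - k) \<bullet> x + (b' - b)) + a * a' / 2 * cos ((l + k) \<bullet> x + (b' + b)))"
  proof
    fix x :: "real^'a"
    have "(l + - k) \<bullet> x + (b' - b) = (l \<bullet> x + b') - (k \<bullet> x + b)"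
      "(l + k) \<bullet> x + (b' + b) = (l \<bullet> x + b') + (k \<bullet> x + b)"
      by (simp_all add: inner_diff_left inner_add_left)
    then show "a' * cos (l \<bullet> x + b') * (a * cos (k \<bullet> x + b)) =
      a * a' / 2 * cos ((l + - k) \<bullet> x + (b' - b)) + a * a' / 2 * cos ((l + k) \<bullet> x + (b' + b))"
      by (simp only: cos_diff cos_add) (simp add: algebra_simps)
  qed
  moreover have "l + - k \<in> dual_lattice \<Lambda>" "l + k \<in> dual_lattice \<Lambda>"
    using wave assms(2) by (metis dual_lattice_add dual_lattice_minus)+
  ultimately show ?case
    by (simp only:) (intro trig_poly.intros)
next
  case (add f g)
  from trig_poly.add[OF add.IH] show ?case by (simp add: algebra_simps)
qed

lemma trig_poly_mult:
  assumes "trig_poly \<Lambda> f" "trig_poly \<Lambda> g"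
  shows "trig_poly \<Lambda> (\<lambda>x. f x * g x)"
  using assms(2)
proof induction
  case (wave k a b)
  then show ?case using trig_poly_wave_mult[OF assms(1)] by simp
next
  case (add f' g')
  from trig_poly.add[OF add.IH] show ?case by (simp add: algebra_simps)
qed

lemma trig_poly_sum:
  assumes "\<And>i. i \<in> I \<Longrightarrow> trig_poly \<Lambda> (f i)"
  shows "trig_poly \<Lambda> (\<lambda>x. \<Sum>i\<in>I. f i x)"
  using assms by (induction I rule: infinite_finite_induct) (auto intro: trig_poly_const trig_poly.add)

lemma wave_has_derivative:
  fixes k :: "real^'n"
  shows "((\<lambda>x. a * cos (k \<bullet> x + b)) has_derivative (\<lambda>h. - a * sin (k \<bullet> x + b) * (k \<bullet> h))) (at x)"
  by (auto intro!: derivative_eq_intros)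

text \<open>The derivative is expressed as a phase shift by pi/2 instead of a sine, so that it is
  again literally a wave and the rule can be iterated by rewriting.\<close>

lemma partial_deriv_wave:
  fixes k :: "real^'n"
  shows "partial_deriv i (\<lambda>x. a * cos (k \<bullet> x + b)) = (\<lambda>x. (a * k $ i) * cos (k \<bullet> x + (b + pi / 2)))"
proof
  fix x :: "real^'n"
  have "cos (k \<bullet> x + (b + pi / 2)) = - sin (k \<bullet> x + b)"
    using minus_sin_cos_eq[of "k \<bullet> x + b"] by (simp add: add.assoc)
  then show "partial_deriv i (\<lambda>x. a * cos (k \<bullet> x + b)) x = (a * k $ i) * cos (k \<bullet> x + (b + pi / 2))"
    by (simp add: partial_deriv_eqI[OF wave_has_derivative] inner_axis)
qed

lemma trig_poly_differentiable:
  assumes "trig_poly \<Lambda> f" shows "f differentiable (at x)"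
  using assms
proof induction
  case (wave k a b)
  show ?case using wave_has_derivative differentiable_def by blast
qed (rule differentiable_add)

lemma trig_poly_partial_deriv_add:
  assumes "trig_poly \<Lambda> f" "trig_poly \<Lambda> g"
  shows "partial_deriv i (\<lambda>x. f x + g x) = (\<lambda>x. partial_deriv i f x + partial_deriv i g x)"
  using assms by (intro ext partial_deriv_add trig_poly_differentiable)

lemma trig_poly_partial_deriv:
  assumes "trig_poly \<Lambda> f" shows "trig_poly \<Lambda> (partial_deriv i f)"
  using assms
proof induction
  case (wave k a b)
  then show ?case unfolding partial_deriv_wave by (rule trig_poly.wave)
next
  case (add f g)
  then show ?case
    by (simp add: trig_poly_partial_deriv_add trig_poly.add)
qed

lemma trig_poly_C_infinity:
  assumes "trig_poly \<Lambda> f" shows "C_infinity f"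
proof -
  have "trig_poly \<Lambda> (foldr partial_deriv is f)" for "is"
    using assms by (induction "is") (auto intro: trig_poly_partial_deriv)
  then show ?thesis
    unfolding C_infinity_def using trig_poly_differentiable by blast
qed

lemma trig_poly_continuous_on:
  assumes "trig_poly \<Lambda> f" shows "continuous_on S f"
  using trig_poly_differentiable[OF assms]
  by (meson continuous_at_imp_continuous_on differentiable_imp_continuous_within)

lemma trig_poly_bounded:
  assumes "trig_poly \<Lambda> f" shows "\<exists>B. \<forall>x. \<bar>f x\<bar> \<le> B"
  using assms
proof induction
  case (wave k a b)
  have "\<bar>a * cos (k \<bullet> x + b)\<bar> \<le> \<bar>a\<bar>" for x
    by (simp add: abs_mult mult_left_le)
  then show ?case by blast
next
  case (add f g)
  then obtain A B where "\<And>x. \<bar>f x\<bar> \<le> A" "\<And>x. \<bar>g x\<bar> \<le> B" by metis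
  then have "\<bar>f x + g x\<bar> \<le> A + B" for x
    by (meson abs_triangle_ineq add_mono order_trans)
  then show ?case by blast
qed

text \<open>The inner product of \<open>k\<close> with a period vector is an integer multiple of 2
  pi. Arbitrary integer translations are allowed because a point of space must later be moved into
  the cell in a single step.\<close>

lemma trig_poly_lattice_periodic:
  fixes f :: "real^'n \<Rightarrow> real" and m :: "'n \<Rightarrow> int"
  assumes "trig_poly \<Lambda> f"
  shows "f (x + (\<chi> i. \<Lambda> * m i)) = f x"
  using assms
proof induction
  case (wave k a b)
  obtain p :: "'n \<Rightarrow> int" where p: "\<And>i. k $ i * \<Lambda> = 2 * pi * p i"
    using wave unfolding dual_lattice_def mem_Collect_eq by metis
  have "k \<bullet> (\<chi> i. \<Lambda> * m i) = (\<Sum>i\<in>UNIV. (k $ i * \<Lambda>) * m i)"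
    by (simp add: inner_vec_def mult.assoc)
  also have "\<dots> = 2 * pi * of_int (\<Sum>i\<in>UNIV. p i * m i)"
    by (simp add: p sum_distrib_left mult.assoc)
  finally have "k \<bullet> (x + (\<chi> i. \<Lambda> * m i)) + b = (k \<bullet> x + b) + 2 * pi * of_int (\<Sum>i\<in>UNIV. p i * m i)"
    by (simp add: inner_add_right)
  moreover have "cos (y + 2 * pi * of_int q) = cos y" for y and q :: int
    by (simp only: cos_add cos_int_2pin sin_int_2pin)
  ultimately show ?case by metis
qed simp

lemma trig_poly_periodic:
  fixes f :: "real^'n \<Rightarrow> real"
  assumes "trig_poly \<Lambda> f" shows "periodic \<Lambda> f"
  unfolding periodic_def
proof (intro allI)
  fix x :: "real^'n" and i :: 'n
  have "axis i \<Lambda> = (\<chi> j. \<Lambda> * of_int (if j = i then 1 else 0))"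
    by (auto simp: vec_eq_iff axis_def)
  then show "f (x + axis i \<Lambda>) = f x"
    using trig_poly_lattice_periodic[OF assms, of x "\<lambda>j. if j = i then 1 else 0"] by simp
qed

lemma trig_poly_helmholtz_solvable:
  assumes "trig_poly \<Lambda> \<psi>" "0 < c"
  shows "\<exists>\<phi>. trig_poly \<Lambda> \<phi> \<and>
    (\<forall>x. c * \<phi> x - (\<Sum>i\<in>UNIV. partial_deriv i (partial_deriv i \<phi>) x) = \<psi> x)"
  using assms(1)
proof induction
  case (wave k a b)
  let ?\<phi> = "\<lambda>x. a / (c + k \<bullet> k) * cos (k \<bullet> x + b)"
  have nz: "c + k \<bullet> k \<noteq> 0" using assms(2) inner_ge_zero[of k] by linarith
  \<comment> \<open>Differentiating twice shifts the phase by pi, which flips the sign. Hence the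
    wave is an eigenfunction of the Laplacian with eigenvalue \<open>- (k \<bullet> k)\<close>, and
    division by \<open>c + k \<bullet> k\<close> inverts the operator.\<close>
  have cos_pi: "cos (k \<bullet> x + (b + pi / 2 + pi / 2)) = - cos (k \<bullet> x + b)" for x
    using cos_periodic_pi[of "k \<bullet> x + b"] by (simp add: add.assoc)
  have "(\<Sum>i\<in>UNIV. partial_deriv i (partial_deriv i ?\<phi>) x) = - (k \<bullet> k) * ?\<phi> x" for x
    unfolding partial_deriv_wave cos_pi
    by (simp add: inner_vec_def[of k k] sum_distrib_left sum_distrib_right sum_divide_distrib
        sum_negf mult_ac)
  then have "c * ?\<phi> x - (\<Sum>i\<in>UNIV. partial_deriv i (partial_deriv i ?\<phi>) x) = (c + k \<bullet> k) * ?\<phi> x" for x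
    by (simp only: distrib_right)
  also have "(c + k \<bullet> k) * ?\<phi> x = a * cos (k \<bullet> x + b)" for x
    using nz by simp
  finally show ?case using trig_poly.wave[OF wave] by blast
next
  case (add f g)
  then obtain \<phi> \<phi>' where *: "trig_poly \<Lambda> \<phi>" "trig_poly \<Lambda> \<phi>'"
    "\<And>x. c * \<phi> x - (\<Sum>i\<in>UNIV. partial_deriv i (partial_deriv i \<phi>) x) = f x"
    "\<And>x. c * \<phi>' x - (\<Sum>i\<in>UNIV. partial_deriv i (partial_deriv i \<phi>') x) = g x"
    by blast
  have "partial_deriv i (partial_deriv i (\<lambda>x. \<phi> x + \<phi>' x)) =
      (\<lambda>x. partial_deriv i (partial_deriv i \<phi>) x + partial_deriv i (partial_deriv i \<phi>') x)" for i
    by (simp only: trig_poly_partial_deriv_add[OF *(1,2)]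
        trig_poly_partial_deriv_add[OF *(1,2)[THEN trig_poly_partial_deriv]])
  then have "c * (\<phi> x + \<phi>' x) -
      (\<Sum>i\<in>UNIV. partial_deriv i (partial_deriv i (\<lambda>x. \<phi> x + \<phi>' x)) x) = f x + g x" for x
    by (simp add: sum.distrib algebra_simps flip: *(3,4))
  then show ?case using trig_poly.add[OF *(1,2)] by blast
qed

section \<open>Integration over the fundamental cell\<close>

text \<open>Cut the translated box at the hyperplane where coordinate \<open>i\<close> equals
  \<Lambda>. The part below is the slab of the original box above \<open>t\<close>; the part beyond,
  moved back by one period, is the missing slab below \<open>t\<close>.\<close>

lemma integral_cbox_periodic_shift:
  fixes F :: "real^'n \<Rightarrow> real"
  assumes F: "continuous_on UNIV F" "\<And>x. F (x + axis i \<Lambda>) = F x" and t: "0 \<le> t" "t \<le> \<Lambda>"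
  shows "integral (cbox 0 (\<chi> i. \<Lambda>)) (\<lambda>x. F (x + t *\<^sub>R axis i 1)) = integral (cbox 0 (\<chi> i. \<Lambda>)) F"
proof -
  let ?L = "(\<chi> i. \<Lambda>) :: real^'n" and ?e = "axis i 1 :: real^'n"
  have int: "F integrable_on cbox a b" for a b
    by (rule integrable_continuous) (use F(1) continuous_on_subset in blast)
  have coord: "x \<bullet> ?e = x $ i" for x by (simp add: inner_axis)
  \<comment> \<open>Isolating coordinate \<open>i\<close> leaves linear arithmetic in that
    coordinate; the others have the same bounds in both boxes.\<close>
  have mem_cbox: "x \<in> cbox a b \<longleftrightarrow> a $ i \<le> x $ i \<and> x $ i \<le> b $ i \<and>
      (\<forall>j. j \<noteq> i \<longrightarrow> a $ j \<le> x $ j \<and> x $ j \<le> b $ j)" for x a b :: "real^'n"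
    unfolding mem_box_cart by metis
  have axis: "axis i c $ i = c" "j \<noteq> i \<Longrightarrow> axis i c $ j = 0" for c :: real and j
    by (simp_all add: axis_def)
  have upper: "cbox (t *\<^sub>R ?e) (?L + t *\<^sub>R ?e) \<inter> {x. x \<bullet> ?e \<le> \<Lambda>} = cbox 0 ?L \<inter> {x. x \<bullet> ?e \<ge> t}"
    unfolding set_eq_iff Int_iff mem_cbox mem_Collect_eq coord
    using t by (auto simp: axis)
  have lower: "cbox (t *\<^sub>R ?e) (?L + t *\<^sub>R ?e) \<inter> {x. x \<bullet> ?e \<ge> \<Lambda>} = cbox (axis i \<Lambda>) (?L + t *\<^sub>R ?e)"
    unfolding set_eq_iff Int_iff mem_cbox mem_Collect_eq coord
    using t by (auto simp: axis)
  \<comment> \<open>The corners are left as unevaluated differences to match the translation rule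
    for integrals over boxes.\<close>
  have lower': "cbox 0 ?L \<inter> {x. x \<bullet> ?e \<le> t} = cbox (axis i \<Lambda> - axis i \<Lambda>) (?L + t *\<^sub>R ?e - axis i \<Lambda>)"
    unfolding set_eq_iff Int_iff mem_cbox mem_Collect_eq coord
    using t by (auto simp: axis)
  have "integral (cbox 0 ?L) (\<lambda>x. F (x + t *\<^sub>R ?e)) = integral (cbox (t *\<^sub>R ?e) (?L + t *\<^sub>R ?e)) F"
    using integral_shift_cbox[of "t *\<^sub>R ?e" "t *\<^sub>R ?e" "?L + t *\<^sub>R ?e" F] by simp
  also have "\<dots> = integral (cbox 0 ?L \<inter> {x. x \<bullet> ?e \<ge> t}) F + integral (cbox (axis i \<Lambda>) (?L + t *\<^sub>R ?e)) F"
    using integral_split[OF int, of ?e "t *\<^sub>R ?e" "?L + t *\<^sub>R ?e" \<Lambda>] by (simp only: upper lower) simp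
  also have "integral (cbox (axis i \<Lambda>) (?L + t *\<^sub>R ?e)) F = integral (cbox 0 ?L \<inter> {x. x \<bullet> ?e \<le> t}) F"
    unfolding lower' using integral_shift_cbox[of "axis i \<Lambda>" "axis i \<Lambda>" "?L + t *\<^sub>R ?e" F] F(2) by simp
  also have "integral (cbox 0 ?L \<inter> {x. x \<bullet> ?e \<ge> t}) F + integral (cbox 0 ?L \<inter> {x. x \<bullet> ?e \<le> t}) F =
    integral (cbox 0 ?L) F"
    using integral_split[OF int, of ?e 0 ?L t] by simp
  finally show ?thesis .
qed

lemma torus_cell_sets [measurable, simp]: "torus_cell \<Lambda> \<in> sets lebesgue"
proof -
  have "torus_cell \<Lambda> = (\<Inter>i. {x :: real^'n. 0 \<le> x $ i} \<inter> {x. x $ i < \<Lambda>})"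
    by (auto simp: torus_cell_def)
  also have "\<dots> \<in> sets borel"
    by (intro sets.finite_INT) (auto intro!: sets.Int borel_closed borel_open
        closed_halfspace_component_ge_cart open_halfspace_component_lt_cart)
  finally show ?thesis by auto
qed

lemma box_subset_torus_cell: "box 0 (\<chi> i. \<Lambda>) \<subseteq> torus_cell \<Lambda>"
  unfolding torus_cell_def by (force simp: mem_box_cart dest: less_imp_le)

lemma torus_cell_subset_cbox: "torus_cell \<Lambda> \<subseteq> cbox 0 (\<chi> i. \<Lambda>)"
  unfolding torus_cell_def by (force simp: mem_box_cart dest: less_imp_le)

text \<open>The two sets differ only within the frontier of the box, which is negligible. This
  passes between the half-open cell and the compact box on which continuous functions are
  handled.\<close>

lemma integral_torus_cell_eq_cbox:
  fixes f :: "real^'n \<Rightarrow> real"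
  shows "integral (torus_cell \<Lambda>) f = integral (cbox 0 (\<chi> i. \<Lambda>)) f"
  using box_subset_torus_cell[of \<Lambda>] torus_cell_subset_cbox[of \<Lambda>]
  by (intro integral_spike_set; intro negligible_subset[OF negligible_frontier_interval]) blast+

section \<open>Integrability over the cell as a finite measure space\<close>

lemma finite_torus_measure [simp]: "finite_measure (torus_measure \<Lambda> :: (real^'n) measure)"
proof
  have "emeasure lebesgue (torus_cell \<Lambda> :: (real^'n) set) \<le> emeasure lebesgue (cbox 0 (\<chi> i. \<Lambda>) :: (real^'n) set)"
    by (rule emeasure_mono[OF torus_cell_subset_cbox]) simp
  also have "\<dots> < \<infinity>"
    by (simp add: emeasure_lborel_cbox_eq)
  finally show "emeasure (torus_measure \<Lambda> :: (real^'n) measure) (space (torus_measure \<Lambda>)) \<noteq> \<infinity>"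
    by (simp add: space_restrict_space emeasure_restrict_space)
qed

lemma continuous_on_torus_measurable:
  fixes f :: "real^'n \<Rightarrow> real"
  assumes "continuous_on UNIV f"
  shows "f \<in> borel_measurable (torus_measure \<Lambda>)"
  using continuous_imp_measurable_on_sets_lebesgue[OF continuous_on_subset[OF assms subset_UNIV]] by simp

lemma integrable_mult_bounded:
  fixes u f :: "'a \<Rightarrow> real"
  assumes "integrable M u" "f \<in> borel_measurable M" "AE x in M. \<bar>f x\<bar> \<le> B"
  shows "integrable M (\<lambda>x. u x * f x)"
proof (rule Bochner_Integration.integrable_bound)
  show "integrable M (\<lambda>x. B * u x)" using assms(1) by simp
  show "(\<lambda>x. u x * f x) \<in> borel_measurable M" using assms(1,2) by measurable
  show "AE x in M. norm (u x * f x) \<le> norm (B * u x)"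
    using assms(3)
  proof eventually_elim
    case (elim x)
    then have "\<bar>f x\<bar> \<le> \<bar>B\<bar>" by linarith
    from mult_left_mono[OF this, of "\<bar>u x\<bar>"] show ?case by (simp add: abs_mult mult.commute)
  qed
qed

lemma integrable_torus_bounded:
  fixes f :: "real^'n \<Rightarrow> real"
  assumes "f \<in> borel_measurable (torus_measure \<Lambda>)" "AE x in torus_measure \<Lambda>. \<bar>f x\<bar> \<le> B"
  shows "integrable (torus_measure \<Lambda>) f"
  by (rule finite_measure.integrable_const_bound[OF finite_torus_measure _ assms(1)])
    (use assms(2) in simp)

lemma continuous_torus_bounded:
  fixes f :: "real^'n \<Rightarrow> real"
  assumes "continuous_on UNIV f"
  shows "\<exists>B. \<forall>x\<in>torus_cell \<Lambda>. \<bar>f x\<bar> \<le> B"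
proof -
  have "compact (f ` cbox 0 (\<chi> i. \<Lambda>))"
    by (intro compact_continuous_image continuous_on_subset[OF assms]) auto
  then have "bounded (f ` cbox 0 (\<chi> i. \<Lambda>))" by (rule compact_imp_bounded)
  then obtain B where "\<And>x. x \<in> cbox 0 (\<chi> i. \<Lambda>) \<Longrightarrow> \<bar>f x\<bar> \<le> B"
    unfolding bounded_iff by auto
  then show ?thesis
    using torus_cell_subset_cbox[of \<Lambda>] by blast
qed

lemma integrable_torus_continuous:
  fixes f :: "real^'n \<Rightarrow> real"
  assumes "continuous_on UNIV f"
  shows "integrable (torus_measure \<Lambda>) f"
proof -
  obtain B where B: "\<And>x. x \<in> torus_cell \<Lambda> \<Longrightarrow> \<bar>f x\<bar> \<le> B"
    using continuous_torus_bounded[OF assms, of \<Lambda>] by blast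
  have "AE x in torus_measure \<Lambda>. \<bar>f x\<bar> \<le> B"
    by (rule AE_I2) (simp add: B)
  then show ?thesis
    by (rule integrable_torus_bounded[OF continuous_on_torus_measurable[OF assms]])
qed

lemma in_L2_continuous:
  fixes f :: "real^'n \<Rightarrow> real"
  assumes "continuous_on UNIV f"
  shows "in_L2 \<Lambda> f"
  unfolding in_L2_def
  using continuous_on_torus_measurable[OF assms]
    integrable_torus_continuous[OF continuous_on_power[OF assms]] by blast

lemma in_L2_integrable:
  assumes "in_L2 \<Lambda> u" shows "integrable (torus_measure \<Lambda>) u"
  using assms unfolding in_L2_def
  by (auto intro: finite_measure.square_integrable_imp_integrable[OF finite_torus_measure])

section \<open>Duality for the Helmholtz equation\<close>

text \<open>The integral of a periodic function over the cell does not change when the function is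
  translated; differentiate in the translation parameter.\<close>

lemma integral_partial_deriv_periodic:
  fixes F :: "real^'n \<Rightarrow> real"
  assumes "0 < \<Lambda>" and diff: "\<And>x. F differentiable (at x)" and "periodic \<Lambda> F"
    and cont: "continuous_on UNIV (partial_deriv i F)"
  shows "(\<integral>x. partial_deriv i F x \<partial>torus_measure \<Lambda>) = 0"
proof -
  let ?L = "(\<chi> i. \<Lambda>) :: real^'n" and ?e = "axis i 1 :: real^'n"
  let ?I = "\<lambda>t. integral (cbox 0 ?L) (\<lambda>x. F (x + t *\<^sub>R ?e))"
  have F: "continuous_on S F" for S
    using diff by (meson continuous_at_imp_continuous_on differentiable_imp_continuous_within)
  have const: "?I t = ?I 0" if "t \<in> {0..\<Lambda>}" for t
  proof -
    have per: "F (x + axis i \<Lambda>) = F x" for x using assms(3) by (simp add: periodic_def)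
    note shift = integral_cbox_periodic_shift[OF F per]
    have "0 \<le> t" "t \<le> \<Lambda>" "0 \<le> \<Lambda>" using that by auto
    then show ?thesis by (simp only: shift order_refl)
  qed
  \<comment> \<open>The derivative at 0 is one-sided, because translation invariance is available
    only for \<open>t\<close> between 0 and \<Lambda>. The Leibniz rule and the constancy of the
    integral give two values for it, which coincide since the interval is nondegenerate.\<close>
  have "(?I has_field_derivative integral (cbox 0 ?L) (\<lambda>x. partial_deriv i F (x + 0 *\<^sub>R ?e))) (at 0 within {0..\<Lambda>})"
  proof (rule leibniz_rule_field_derivative)
    show "((\<lambda>t. F (x + t *\<^sub>R ?e)) has_field_derivative partial_deriv i F (x + t *\<^sub>R ?e)) (at t within {0..\<Lambda>})" for x t
      by (rule has_field_derivative_at_within[OF has_real_derivative_along_axis[OF diff]])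
    show "(\<lambda>x. F (x + t *\<^sub>R ?e)) integrable_on cbox 0 ?L" for t
      by (rule integrable_continuous, rule continuous_on_compose2[OF F[of UNIV]])
        (auto intro!: continuous_intros)
    show "continuous_on ({0..\<Lambda>} \<times> cbox 0 ?L) (\<lambda>(t, x). partial_deriv i F (x + t *\<^sub>R ?e))"
      unfolding case_prod_beta
      by (rule continuous_on_compose2[OF cont]) (auto intro!: continuous_intros)
  qed (use \<open>0 < \<Lambda>\<close> in auto)
  moreover have "(?I has_field_derivative 0) (at 0 within {0..\<Lambda>})"
  proof (rule has_field_derivative_transform_within[OF DERIV_const[of "?I 0"] zero_less_one])
    show "?I 0 = ?I t" if "t \<in> {0..\<Lambda>}" for t by (rule const[OF that, symmetric])
  qed (use \<open>0 < \<Lambda>\<close> in simp)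
  ultimately have "integral (cbox 0 ?L) (\<lambda>x. partial_deriv i F (x + 0 *\<^sub>R ?e)) = 0"
    unfolding has_real_derivative_iff_has_vector_derivative box_real(2)[symmetric]
    by (rule vector_derivative_unique_within_closed_interval[rotated 2]) (use \<open>0 < \<Lambda>\<close> in auto)
  then have "integral (cbox 0 ?L) (partial_deriv i F) = 0" by simp
  then show ?thesis
    using lebesgue_integral_eq_integral[OF integrable_torus_continuous[OF cont] torus_cell_sets]
    by (simp add: integral_torus_cell_eq_cbox)
qed

section \<open>Trigonometric polynomials as test functions in the weak formulation\<close>

lemma C_infinity_differentiable:
  assumes "C_infinity f"
  shows "f differentiable (at x)" and "partial_deriv i f differentiable (at x)"
  using assms[unfolded C_infinity_def, rule_format, of "[]"]
    assms[unfolded C_infinity_def, rule_format, of "[i]"] by simp_all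

lemma differentiable_imp_continuous_on_UNIV:
  assumes "\<And>x. f differentiable (at x)" shows "continuous_on UNIV f"
  using assms by (meson continuous_at_imp_continuous_on differentiable_imp_continuous_within)

text \<open>Integration by parts: the product \<open>u x * \<phi> x\<close> is periodic, so its
  partial derivative has integral zero, and the product rule splits that integral. This makes
  trigonometric polynomials, with their classical gradients, admissible in the weak
  formulation.\<close>

lemma trig_poly_H1:
  fixes u :: "real^'n \<Rightarrow> real"
  assumes "0 < \<Lambda>" and u: "trig_poly \<Lambda> u"
  shows "H1_with_gradient \<Lambda> u (\<lambda>x. \<chi> i. partial_deriv i u x)"
  unfolding H1_with_gradient_def
proof (intro conjI allI impI; (elim conjE)?)
  show "in_L2 \<Lambda> u" by (rule in_L2_continuous[OF trig_poly_continuous_on[OF u]])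
  fix i
  note u' = trig_poly_partial_deriv[OF u, of i]
  show "in_L2 \<Lambda> (\<lambda>x. (\<chi> i. partial_deriv i u x) $ i)"
    using in_L2_continuous[OF trig_poly_continuous_on[OF u']] by simp
  fix \<phi> :: "real^'n \<Rightarrow> real" assume \<phi>: "C_infinity \<phi>" "periodic \<Lambda> \<phi>"
  note cont = trig_poly_continuous_on[OF u] trig_poly_continuous_on[OF u']
    differentiable_imp_continuous_on_UNIV[OF C_infinity_differentiable(1)[OF \<phi>(1)]]
    differentiable_imp_continuous_on_UNIV[OF C_infinity_differentiable(2)[OF \<phi>(1), of i]]
  have prod: "partial_deriv i (\<lambda>x. u x * \<phi> x) = (\<lambda>x. u x * partial_deriv i \<phi> x + partial_deriv i u x * \<phi> x)"
    by (rule ext, rule partial_deriv_mult[OF trig_poly_differentiable[OF u] C_infinity_differentiable(1)[OF \<phi>(1)]])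
  have "(\<integral>x. partial_deriv i (\<lambda>x. u x * \<phi> x) x \<partial>torus_measure \<Lambda>) = 0"
  proof (rule integral_partial_deriv_periodic[OF \<open>0 < \<Lambda>\<close>])
    show "(\<lambda>x. u x * \<phi> x) differentiable (at x)" for x
      by (rule differentiable_mult[OF trig_poly_differentiable[OF u] C_infinity_differentiable(1)[OF \<phi>(1)]])
    show "periodic \<Lambda> (\<lambda>x. u x * \<phi> x)"
      using trig_poly_periodic[OF u] \<phi>(2) by (simp add: periodic_def)
    show "continuous_on UNIV (partial_deriv i (\<lambda>x. u x * \<phi> x))"
      unfolding prod by (intro continuous_intros cont)
  qed
  also have "(\<integral>x. partial_deriv i (\<lambda>x. u x * \<phi> x) x \<partial>torus_measure \<Lambda>) =
      (\<integral>x. u x * partial_deriv i \<phi> x \<partial>torus_measure \<Lambda>) + (\<integral>x. partial_deriv i u x * \<phi> x \<partial>torus_measure \<Lambda>)"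
    unfolding prod by (intro Bochner_Integration.integral_add integrable_torus_continuous continuous_intros cont)
  finally show "(\<integral>x. u x * partial_deriv i \<phi> x \<partial>torus_measure \<Lambda>) =
      - (\<integral>x. (\<chi> i. partial_deriv i u x) $ i * \<phi> x \<partial>torus_measure \<Lambda>)"
    by simp
qed

lemma integrable_mult_trig_poly:
  fixes v :: "real^'n \<Rightarrow> real"
  assumes "integrable (torus_measure \<Lambda>) v" "trig_poly \<Lambda> \<psi>"
  shows "integrable (torus_measure \<Lambda>) (\<lambda>x. v x * \<psi> x)"
proof -
  obtain B where "\<forall>x. \<bar>\<psi> x\<bar> \<le> B" using trig_poly_bounded[OF assms(2)] by blast
  then show ?thesis
    by (intro integrable_mult_bounded[where B = B] assms(1)
        continuous_on_torus_measurable trig_poly_continuous_on[OF assms(2)]) simp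
qed

lemma helmholtz_weak_solution_in_L2: "helmholtz_weak_solution \<Lambda> c f w \<Longrightarrow> in_L2 \<Lambda> w"
  unfolding helmholtz_weak_solution_def H1_with_gradient_def by blast

text \<open>The two integrations by parts hidden here are the definition of the weak gradient, applied with
  the test function \<open>\<partial>\<^sub>i \<phi>\<close>, and the weak formulation, applied with \<open>\<phi>\<close>.\<close>

lemma helmholtz_weak_solution_adjoint:
  fixes w :: "real^'n \<Rightarrow> real"
  assumes "0 < \<Lambda>" and sol: "helmholtz_weak_solution \<Lambda> c f w" and \<phi>: "trig_poly \<Lambda> \<phi>"
    and eq: "\<And>x. c * \<phi> x - (\<Sum>i\<in>UNIV. partial_deriv i (partial_deriv i \<phi>) x) = \<psi> x"
  shows "(\<integral>x. w x * \<psi> x \<partial>torus_measure \<Lambda>) = c * (\<integral>x. f x * \<phi> x \<partial>torus_measure \<Lambda>)"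
proof -
  let ?M = "torus_measure \<Lambda> :: (real^'n) measure"
  from sol obtain G where G: "H1_with_gradient \<Lambda> w G"
    and weak: "\<And>\<phi> H. H1_with_gradient \<Lambda> \<phi> H \<Longrightarrow>
      c * (\<integral>x. w x * \<phi> x \<partial>?M) + (\<integral>x. G x \<bullet> H x \<partial>?M) = c * (\<integral>x. f x * \<phi> x \<partial>?M)"
    unfolding helmholtz_weak_solution_def by blast
  note d\<phi> = trig_poly_partial_deriv[OF \<phi>]
  have int_w: "integrable ?M w" and int_G: "integrable ?M (\<lambda>x. G x $ i)" for i
    using G in_L2_integrable unfolding H1_with_gradient_def by blast+
  have parts: "(\<integral>x. w x * partial_deriv i (partial_deriv i \<phi>) x \<partial>?M) =
      - (\<integral>x. G x $ i * partial_deriv i \<phi> x \<partial>?M)" for i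
    using G trig_poly_C_infinity[OF d\<phi>] trig_poly_periodic[OF d\<phi>]
    unfolding H1_with_gradient_def by blast
  have "(\<integral>x. w x * \<psi> x \<partial>?M) =
      (\<integral>x. c * (w x * \<phi> x) - (\<Sum>i\<in>UNIV. w x * partial_deriv i (partial_deriv i \<phi>) x) \<partial>?M)"
    by (simp add: algebra_simps sum_distrib_left flip: eq)
  also have "\<dots> = c * (\<integral>x. w x * \<phi> x \<partial>?M) -
      (\<Sum>i\<in>UNIV. \<integral>x. w x * partial_deriv i (partial_deriv i \<phi>) x \<partial>?M)"
    using integrable_mult_trig_poly[OF int_w \<phi>]
      integrable_mult_trig_poly[OF int_w trig_poly_partial_deriv[OF d\<phi>]] by simp
  also have "\<dots> = c * (\<integral>x. w x * \<phi> x \<partial>?M) + (\<Sum>i\<in>UNIV. \<integral>x. G x $ i * partial_deriv i \<phi> x \<partial>?M)"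
    by (simp add: parts sum_negf)
  also have "(\<Sum>i\<in>UNIV. \<integral>x. G x $ i * partial_deriv i \<phi> x \<partial>?M) =
      (\<integral>x. G x \<bullet> (\<chi> i. partial_deriv i \<phi> x) \<partial>?M)"
    using integrable_mult_trig_poly[OF int_G d\<phi>] by (simp add: inner_vec_def)
  finally show ?thesis
    using weak[OF trig_poly_H1[OF \<open>0 < \<Lambda>\<close> \<phi>]] by simp
qed

text \<open>The counterpart of the preceding identity with \<open>w\<close> and \<open>f\<close>
  both replaced by the constant 1; the second derivatives integrate to zero by periodicity. It is
  the reference value for the upper bound on \<open>w\<close>.\<close>

lemma integral_trig_poly_adjoint:
  fixes \<phi> :: "real^'n \<Rightarrow> real"
  assumes "0 < \<Lambda>" and \<phi>: "trig_poly \<Lambda> \<phi>"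
    and eq: "\<And>x. c * \<phi> x - (\<Sum>i\<in>UNIV. partial_deriv i (partial_deriv i \<phi>) x) = \<psi> x"
  shows "(\<integral>x. \<psi> x \<partial>torus_measure \<Lambda>) = c * (\<integral>x. \<phi> x \<partial>torus_measure \<Lambda>)"
proof -
  let ?M = "torus_measure \<Lambda> :: (real^'n) measure"
  have d\<phi>: "trig_poly \<Lambda> (partial_deriv i \<phi>)" "trig_poly \<Lambda> (partial_deriv i (partial_deriv i \<phi>))" for i
    by (intro trig_poly_partial_deriv \<phi>)+
  have "(\<integral>x. partial_deriv i (partial_deriv i \<phi>) x \<partial>?M) = 0" for i
    by (rule integral_partial_deriv_periodic[OF \<open>0 < \<Lambda>\<close> trig_poly_differentiable[OF d\<phi>(1)]
          trig_poly_periodic[OF d\<phi>(1)] trig_poly_continuous_on[OF d\<phi>(2)]])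
  moreover have "integrable ?M \<phi>" "integrable ?M (partial_deriv i (partial_deriv i \<phi>))" for i
    using integrable_torus_continuous[OF trig_poly_continuous_on] \<phi> d\<phi>(2) by blast+
  ultimately show ?thesis
    by (simp flip: eq)
qed

text \<open>If \<open>l\<close> were negative, \<open>g'\<close>, which vanishes at the minimum,
  would be negative just to the right of it, and \<open>g\<close> would fall below its minimal
  value.\<close>

lemma second_derivative_nonneg_at_min:
  fixes g g' :: "real \<Rightarrow> real"
  assumes "\<And>t. (g has_real_derivative g' t) (at t)" "(g' has_real_derivative l) (at x)"
    and min: "\<And>t. g x \<le> g t"
  shows "0 \<le> l"
proof (rule ccontr)
  assume "\<not> 0 \<le> l"
  have "g' x = 0"
    using DERIV_local_min[OF assms(1), of 1 x] min by simp
  with DERIV_neg_dec_right[OF assms(2)] \<open>\<not> 0 \<le> l\<close>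
  obtain d where "d > 0" and d: "\<And>h. 0 < h \<Longrightarrow> h < d \<Longrightarrow> g' (x + h) < 0" by auto
  have "g (x + d / 2) < g x"
  proof (rule DERIV_neg_imp_decreasing_open[of x "x + d / 2" g])
    show "\<exists>y. (g has_real_derivative y) (at s) \<and> y < 0" if "x < s" "s < x + d / 2" for s
      using assms(1)[of s] d[of "s - x"] that by auto
    show "continuous_on {x..x + d / 2} g"
      by (intro continuous_at_imp_continuous_on ballI DERIV_isCont[OF assms(1)])
  qed (use \<open>d > 0\<close> in simp)
  with min[of "x + d / 2"] show False by linarith
qed

text \<open>A minimum over the closed box exists by compactness and is global, since every point has
  a lattice translate in the box.\<close>

lemma trig_poly_attains_min:
  fixes f :: "real^'n \<Rightarrow> real"
  assumes "0 < \<Lambda>" "trig_poly \<Lambda> f"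
  shows "\<exists>x. \<forall>y. f x \<le> f y"
proof -
  have "cbox 0 (\<chi> i. \<Lambda>) \<noteq> ({} :: (real^'n) set)"
    using \<open>0 < \<Lambda>\<close> by (simp add: interval_ne_empty_cart)
  then obtain x where x: "\<And>y. y \<in> cbox 0 (\<chi> i. \<Lambda>) \<Longrightarrow> f x \<le> f y"
    using continuous_attains_inf[OF compact_cbox _ trig_poly_continuous_on[OF assms(2)]] by metis
  have "f x \<le> f y" for y
  proof -
    \<comment> \<open>Subtracting the integer part of each \<open>y $ i / \<Lambda>\<close> moves
      \<open>y\<close> into the box.\<close>
    let ?m = "\<lambda>i. - \<lfloor>y $ i / \<Lambda>\<rfloor>"
    have "y + (\<chi> i. \<Lambda> * ?m i) \<in> cbox 0 (\<chi> i. \<Lambda>)"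
      unfolding mem_box_cart
    proof
      fix i
      have "\<Lambda> * of_int \<lfloor>y $ i / \<Lambda>\<rfloor> \<le> y $ i" "y $ i \<le> \<Lambda> * of_int \<lfloor>y $ i / \<Lambda>\<rfloor> + \<Lambda>"
        using floor_divide_lower[OF \<open>0 < \<Lambda>\<close>, of "y $ i"] floor_divide_upper[OF \<open>0 < \<Lambda>\<close>, of "y $ i"]
        by (simp_all add: algebra_simps)
      then show "0 $ i \<le> (y + (\<chi> i. \<Lambda> * ?m i)) $ i \<and> (y + (\<chi> i. \<Lambda> * ?m i)) $ i \<le> (\<chi> i. \<Lambda>) $ i"
        by simp
    qed
    then show ?thesis
      using x trig_poly_lattice_periodic[OF assms(2), of y ?m] by metis
  qed
  then show ?thesis by blast
qed

text \<open>At a global minimum all pure second partial derivatives are nonnegative, so the assumed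
  inequality forces \<open>c * \<phi> x\<close> to be nonnegative there, and with it \<phi>
  everywhere.\<close>

lemma trig_poly_min_principle:
  fixes \<phi> :: "real^'n \<Rightarrow> real"
  assumes "0 < \<Lambda>" "0 < c" and \<phi>: "trig_poly \<Lambda> \<phi>"
    and nonneg: "\<And>x. 0 \<le> c * \<phi> x - (\<Sum>i\<in>UNIV. partial_deriv i (partial_deriv i \<phi>) x)"
  shows "0 \<le> \<phi> y"
proof -
  obtain x where x: "\<And>y. \<phi> x \<le> \<phi> y"
    using trig_poly_attains_min[OF \<open>0 < \<Lambda>\<close> \<phi>] by blast
  have "0 \<le> partial_deriv i (partial_deriv i \<phi>) x" for i
  proof (rule second_derivative_nonneg_at_min)
    show "((\<lambda>t. \<phi> (x + t *\<^sub>R axis i 1)) has_real_derivative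
        partial_deriv i \<phi> (x + t *\<^sub>R axis i 1)) (at t)" for t
      by (intro has_real_derivative_along_axis trig_poly_differentiable[OF \<phi>])
    show "((\<lambda>t. partial_deriv i \<phi> (x + t *\<^sub>R axis i 1)) has_real_derivative
        partial_deriv i (partial_deriv i \<phi>) x) (at 0)"
      using has_real_derivative_along_axis[OF trig_poly_differentiable[OF trig_poly_partial_deriv[OF \<phi>]], where x = x and t = 0]
      by simp
  qed (simp add: x)
  then have "0 \<le> (\<Sum>i\<in>UNIV. partial_deriv i (partial_deriv i \<phi>) x)" by (simp add: sum_nonneg)
  with nonneg[of x] have "0 \<le> c * \<phi> x" by linarith
  then have "0 \<le> \<phi> x" using \<open>0 < c\<close> by (simp add: zero_le_mult_iff)
  with x[of y] show ?thesis by linarith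
qed

section \<open>Density of trigonometric polynomials\<close>

text \<open>The half-open cell is not compact, and trigonometric polynomials do not separate opposite faces
  of its closure; Stone-Weierstrass is applied after embedding the torus as a product of circles.\<close>

definition torus_embedding :: "real \<Rightarrow> real^'n \<Rightarrow> (real^'n) \<times> (real^'n)" where
  "torus_embedding \<Lambda> x = ((\<chi> i. cos (2 * pi / \<Lambda> * x $ i)), (\<chi> i. sin (2 * pi / \<Lambda> * x $ i)))"

text \<open>The coordinates of the embedding are themselves waves with wave vectors along the axes,
  and trigonometric polynomials form an algebra. Thus polynomial approximation in the ambient space
  becomes trigonometric approximation on the torus.\<close>

lemma trig_poly_polynomial_torus_embedding:
  assumes "real_polynomial_function p" "\<Lambda> \<noteq> 0"
  shows "trig_poly \<Lambda> (\<lambda>x :: real^'n. p (torus_embedding \<Lambda> x))"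
  using assms(1)
proof induction
  case (linear f)
  interpret f: bounded_linear f by fact
  have expand: "f z = (\<Sum>b\<in>Basis. f b * (z \<bullet> b))" for z
    using f.sum[of "\<lambda>b. (z \<bullet> b) *\<^sub>R b" Basis] by (simp add: euclidean_representation f.scaleR mult.commute)
  have wave: "trig_poly \<Lambda> (\<lambda>x :: real^'n. 1 * cos (axis i (2 * pi / \<Lambda>) \<bullet> x + b))" for i b
    by (intro trig_poly.wave dual_lattice_axis assms)
  have "trig_poly \<Lambda> (\<lambda>x :: real^'n. cos (2 * pi / \<Lambda> * x $ i))" for i
    using wave[of i 0] by (simp add: inner_axis')
  moreover have "trig_poly \<Lambda> (\<lambda>x :: real^'n. sin (2 * pi / \<Lambda> * x $ i))" for i
    \<comment> \<open>The phase \<open>- pi / 2\<close> turns the cosine into a sine.\<close>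
    using wave[of i "- pi / 2"] by (simp add: inner_axis' cos_diff)
  ultimately have "trig_poly \<Lambda> (\<lambda>x :: real^'n. torus_embedding \<Lambda> x \<bullet> b)" if b: "b \<in> Basis" for b
  proof -
    consider i where "b = (axis i 1, 0)" | i where "b = (0, axis i 1)"
      using b unfolding Basis_prod_def Basis_vec_def by auto
    then show ?thesis
    proof cases
      case 1
      show ?thesis unfolding 1 torus_embedding_def
        using \<open>\<And>i. trig_poly \<Lambda> (\<lambda>x. cos (2 * pi / \<Lambda> * x $ i))\<close> by (simp add: inner_axis)
    next
      case 2
      show ?thesis unfolding 2 torus_embedding_def
        using \<open>\<And>i. trig_poly \<Lambda> (\<lambda>x. sin (2 * pi / \<Lambda> * x $ i))\<close> by (simp add: inner_axis)
    qed
  qed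
  then have "trig_poly \<Lambda> (\<lambda>x. \<Sum>b\<in>Basis. f b * (torus_embedding \<Lambda> x \<bullet> b))"
    by (intro trig_poly_sum trig_poly_mult trig_poly_const)
  then show ?case by (simp flip: expand)
next
  case (const c)
  show ?case by (rule trig_poly_const)
next
  case (add f g)
  show ?case by (rule trig_poly.add[OF add.IH])
next
  case (mult f g)
  show ?case by (rule trig_poly_mult[OF mult.IH])
qed

lemma torus_embedding_inj:
  assumes "0 < \<Lambda>" shows "inj_on (torus_embedding \<Lambda>) (torus_cell \<Lambda>)"
proof (rule inj_onI)
  fix x y :: "real^'n"
  assume x: "x \<in> torus_cell \<Lambda>" and y: "y \<in> torus_cell \<Lambda>"
    and eq: "torus_embedding \<Lambda> x = torus_embedding \<Lambda> y"
  show "x = y"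
    unfolding vec_eq_iff
  proof
    fix i
    have "sin (2 * pi / \<Lambda> * x $ i) = sin (2 * pi / \<Lambda> * y $ i) \<and> cos (2 * pi / \<Lambda> * x $ i) = cos (2 * pi / \<Lambda> * y $ i)"
      using eq by (simp add: torus_embedding_def vec_eq_iff)
    then obtain n :: int where "2 * pi / \<Lambda> * x $ i = 2 * pi / \<Lambda> * y $ i + 2 * pi * n"
      using sin_cos_eq_iff by blast
    moreover have "z = \<Lambda> / (2 * pi) * (2 * pi / \<Lambda> * z)" for z
      using \<open>0 < \<Lambda>\<close> by simp
    ultimately have "x $ i = \<Lambda> / (2 * pi) * (2 * pi / \<Lambda> * y $ i + 2 * pi * n)"
      by metis
    then have n: "x $ i - y $ i = \<Lambda> * n"
      using \<open>0 < \<Lambda>\<close> by (simp add: distrib_left)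
    \<comment> \<open>The strict inequality comes from the half-openness of the cell; it is what
      excludes all nonzero integers \<open>n\<close>.\<close>
    have "\<bar>x $ i - y $ i\<bar> < \<Lambda>"
      using x y unfolding torus_cell_def mem_Collect_eq by (smt (verit))
    then have "\<Lambda> * \<bar>of_int n\<bar> < \<Lambda> * 1"
      using \<open>0 < \<Lambda>\<close> by (simp add: n abs_mult)
    then have "\<bar>of_int n :: real\<bar> < 1"
      using \<open>0 < \<Lambda>\<close> mult_less_cancel_left_pos by blast
    then have "n = 0" by linarith
    with n show "x $ i = y $ i" by simp
  qed
qed

lemma torus_embedding_continuous: "continuous_on S (torus_embedding \<Lambda>)"
  unfolding torus_embedding_def by (intro continuous_intros)

text \<open>Supplies a fixed compact set containing the image, on which Stone-Weierstrass is
  applied.\<close>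

lemma torus_embedding_mem_cbox: "torus_embedding \<Lambda> x \<in> cbox (- 1) 1 \<times> cbox (- 1) 1"
  by (simp add: torus_embedding_def mem_box_cart)

text \<open>Tent functions of the distance to the embedded \<open>K\<close> converge to its
  indicator. They are approximated uniformly by polynomials and lifted slightly to stay nonnegative;
  the common bound prepares dominated convergence.\<close>

lemma indicator_limit_trig_poly:
  fixes K :: "(real^'n) set"
  assumes "0 < \<Lambda>" "compact K" "K \<subseteq> torus_cell \<Lambda>"
  shows "\<exists>\<psi>. (\<forall>m::nat. trig_poly \<Lambda> (\<psi> m) \<and> (\<forall>x. 0 \<le> \<psi> m x \<and> \<psi> m x \<le> 3)) \<and>
    (\<forall>x\<in>torus_cell \<Lambda>. (\<lambda>m. \<psi> m x) \<longlonglongrightarrow> indicator K x)"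
\<comment> \<open>The empty set is treated apart because \<open>infdist\<close> to it is 0 by
  convention, so the tents below would be constantly 1.\<close>
proof (cases "K = {}")
  case True
  then show ?thesis
    by (intro exI[of _ "\<lambda>m x. 0"]) (simp add: trig_poly_const)
next
  case False
  let ?E = "torus_embedding \<Lambda> :: real^'n \<Rightarrow> _" and ?S = "cbox (- 1) 1 \<times> cbox (- 1) 1 :: ((real^'n) \<times> (real^'n)) set"
  \<comment> \<open>The tent equals 1 on the image of \<open>K\<close> and vanishes where the
    distance to that image is at least \<open>1 / m\<close>, for positive \<open>m\<close>.\<close>
  define g where "g m z = max 0 (1 - real m * infdist z (?E ` K))" for m :: nat and z
  let ?e = "\<lambda>m. inverse (real (Suc m))"
  have "\<exists>p. real_polynomial_function p \<and> (\<forall>z\<in>?S. \<bar>g m z - p z\<bar> < ?e m)" for m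
  proof -
    have "continuous_on ?S (g m)" unfolding g_def by (intro continuous_intros)
    moreover have "compact ?S" by (intro compact_Times compact_cbox)
    moreover have "0 < ?e m" by simp
    ultimately obtain p where "real_polynomial_function p" "\<And>z. z \<in> ?S \<Longrightarrow> \<bar>g m z - p z\<bar> < ?e m"
      using Stone_Weierstrass_real_polynomial_function[of ?S "g m" "?e m"] by metis
    then show ?thesis by metis
  qed
  then have "\<forall>m. \<exists>p. real_polynomial_function p \<and> (\<forall>z\<in>?S. \<bar>g m z - p z\<bar> < ?e m)" ..
  from choice[OF this] obtain p where p: "\<And>m. real_polynomial_function (p m)"
    and approx: "\<And>m z. z \<in> ?S \<Longrightarrow> \<bar>g m z - p m z\<bar> < ?e m"
    by blast
  \<comment> \<open>Adding the approximation error makes the polynomial nonnegative. The total error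
    is then at most twice \<open>?e m\<close>, and the bound 3 is the tent's maximum 1 plus
    2.\<close>
  define \<psi> where "\<psi> = (\<lambda>m x. p m (?E x) + ?e m)"
  have close: "0 \<le> \<psi> m x" "\<bar>\<psi> m x - g m (?E x)\<bar> \<le> 2 * ?e m" "\<psi> m x \<le> 3" for m x
  proof -
    have bounds: "0 \<le> a + e \<and> \<bar>a + e - g\<bar> \<le> 2 * e \<and> a + e \<le> 3"
      if "0 \<le> g" "g \<le> 1" "\<bar>g - a\<bar> < e" "e \<le> 1" for a e g :: real
      using that by linarith
    have "?e m \<le> 1" by (simp add: field_simps)
    moreover have "0 \<le> g m (?E x)" by (simp add: g_def)
    moreover have "g m (?E x) \<le> 1" by (simp add: g_def infdist_nonneg)
    ultimately show "0 \<le> \<psi> m x" "\<bar>\<psi> m x - g m (?E x)\<bar> \<le> 2 * ?e m" "\<psi> m x \<le> 3"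
      unfolding \<psi>_def using bounds[OF _ _ approx[OF torus_embedding_mem_cbox]] by blast+
  qed
  have "(\<lambda>m. \<psi> m x) \<longlonglongrightarrow> indicator K x" if x: "x \<in> torus_cell \<Lambda>" for x
  proof -
    have "\<forall>\<^sub>F m in sequentially. g m (?E x) = indicator K x"
    proof (cases "x \<in> K")
      case True
      then show ?thesis by (simp add: g_def)
    next
      case out: False
      have "closed (?E ` K)"
        by (intro compact_imp_closed compact_continuous_image torus_embedding_continuous assms)
      \<comment> \<open>Injectivity on the cell keeps the image of an outside point away from the
        image of \<open>K\<close>; closedness then gives a positive distance.\<close>
      moreover have "?E x \<notin> ?E ` K"
        using out x assms(3) torus_embedding_inj[OF \<open>0 < \<Lambda>\<close>] by (auto dest: inj_onD)
      ultimately have d: "infdist (?E x) (?E ` K) > 0"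
        using False by (simp add: infdist_pos_not_in_closed)
      obtain N :: nat where N: "1 / infdist (?E x) (?E ` K) < N" using reals_Archimedean2 by blast
      have "g m (?E x) = indicator K x" if "N \<le> m" for m
      proof -
        have "1 / infdist (?E x) (?E ` K) \<le> real m" using N that by linarith
        then have "1 \<le> real m * infdist (?E x) (?E ` K)" using d by (simp add: divide_le_eq)
        then show ?thesis using out by (simp add: g_def)
      qed
      then show ?thesis unfolding eventually_sequentially by blast
    qed
    then have g: "(\<lambda>m. g m (?E x)) \<longlonglongrightarrow> indicator K x"
      by (rule tendsto_eventually)
    have "(\<lambda>m. \<psi> m x - g m (?E x)) \<longlonglongrightarrow> 0"
    proof (rule Lim_null_comparison)
      show "\<forall>\<^sub>F m in sequentially. norm (\<psi> m x - g m (?E x)) \<le> 2 * ?e m"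
        unfolding real_norm_def by (intro always_eventually allI close(2))
      show "(\<lambda>m. 2 * ?e m) \<longlonglongrightarrow> 0"
        using tendsto_mult_left[OF LIMSEQ_inverse_real_of_nat, of 2] by simp
    qed
    from tendsto_add[OF this g] show ?thesis by simp
  qed
  moreover have "trig_poly \<Lambda> (\<psi> m)" for m
    unfolding \<psi>_def using \<open>0 < \<Lambda>\<close>
    by (intro trig_poly.add trig_poly_const trig_poly_polynomial_torus_embedding p) simp
  ultimately show ?thesis using close(1,3) by blast
qed

text \<open>Replace the indicator of \<open>K\<close> by the approximating trigonometric polynomials
  and pass to the limit by dominated convergence with majorant
  \<open>3 * \<bar>v x\<bar>\<close>.\<close>

lemma integral_compact_nonneg:
  fixes v :: "real^'n \<Rightarrow> real"
  assumes "0 < \<Lambda>" and v: "integrable (torus_measure \<Lambda>) v"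
    and pos: "\<And>\<psi>. trig_poly \<Lambda> \<psi> \<Longrightarrow> (\<And>x. 0 \<le> \<psi> x) \<Longrightarrow> 0 \<le> (\<integral>x. v x * \<psi> x \<partial>torus_measure \<Lambda>)"
    and K: "compact K" "K \<subseteq> torus_cell \<Lambda>"
  shows "0 \<le> (\<integral>x. v x * indicator K x \<partial>torus_measure \<Lambda>)"
proof -
  let ?M = "torus_measure \<Lambda> :: (real^'n) measure"
  obtain \<psi> where \<psi>: "\<And>m. trig_poly \<Lambda> (\<psi> m)" "\<And>m x. 0 \<le> \<psi> m x" "\<And>m x. \<psi> m x \<le> 3"
    and lim: "\<And>x. x \<in> torus_cell \<Lambda> \<Longrightarrow> (\<lambda>m::nat. \<psi> m x) \<longlonglongrightarrow> indicator K x"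
    using indicator_limit_trig_poly[OF \<open>0 < \<Lambda>\<close> K] by blast
  have "K \<in> sets ?M"
    using K by (auto simp: sets_restrict_space_iff compact_imp_closed borel_closed)
  then have "(\<lambda>x. v x * indicator K x) \<in> borel_measurable ?M"
    using borel_measurable_integrable[OF v] by measurable
  moreover have "(\<lambda>x. v x * \<psi> m x) \<in> borel_measurable ?M" for m
    using integrable_mult_trig_poly[OF v \<psi>(1)] by (rule borel_measurable_integrable)
  moreover have "integrable ?M (\<lambda>x. 3 * \<bar>v x\<bar>)" using v by simp
  moreover have "AE x in ?M. (\<lambda>m. v x * \<psi> m x) \<longlonglongrightarrow> v x * indicator K x"
    by (rule AE_I2) (simp add: lim tendsto_mult_left)
  moreover have "AE x in ?M. norm (v x * \<psi> m x) \<le> 3 * \<bar>v x\<bar>" for m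
  proof (rule AE_I2)
    fix x
    have "\<bar>v x\<bar> * \<bar>\<psi> m x\<bar> \<le> \<bar>v x\<bar> * 3"
      using \<psi>(2,3)[of m x] by (intro mult_left_mono) auto
    then show "norm (v x * \<psi> m x) \<le> 3 * \<bar>v x\<bar>" by (simp add: abs_mult)
  qed
  ultimately have "(\<lambda>m. \<integral>x. v x * \<psi> m x \<partial>?M) \<longlonglongrightarrow> (\<integral>x. v x * indicator K x \<partial>?M)"
    by (rule integral_dominated_convergence)
  then show ?thesis
    by (rule LIMSEQ_le_const) (use pos \<psi> in blast)
qed

text \<open>Up to a null set, the set where \<open>v\<close> is negative is a countable union of
  compact sets. On each of these the integral of \<open>v\<close> is nonnegative although
  \<open>v\<close> is negative there, so each is null.\<close>

lemma AE_nonneg_if_trig_poly_moments_nonneg: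
  fixes v :: "real^'n \<Rightarrow> real"
  assumes "0 < \<Lambda>" and v: "integrable (torus_measure \<Lambda>) v"
    and pos: "\<And>\<psi>. trig_poly \<Lambda> \<psi> \<Longrightarrow> (\<And>x. 0 \<le> \<psi> x) \<Longrightarrow> 0 \<le> (\<integral>x. v x * \<psi> x \<partial>torus_measure \<Lambda>)"
  shows "AE x in torus_measure \<Lambda>. 0 \<le> v x"
proof -
  let ?M = "torus_measure \<Lambda> :: (real^'n) measure"
  let ?N = "{x \<in> torus_cell \<Lambda>. v x < 0}"
  note [measurable] = borel_measurable_integrable[OF v]
  have "{x \<in> space ?M. v x < 0} \<in> sets ?M" by measurable
  then have "?N \<in> sets lebesgue" by (simp add: sets_restrict_space_iff)
  then obtain C T where CT: "fsigma C" "T \<in> null_sets lebesgue" "C \<union> T = ?N"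
    by (rule lebesgue_set_almost_fsigma)
  obtain F :: "nat \<Rightarrow> (real^'n) set" where F: "\<And>n. closed (F n)" "C = (\<Union>n. F n)"
    using CT(1) by (rule fsigma.cases) blast
  have "AE x in ?M. x \<notin> F n" for n
  proof -
    have sub: "F n \<subseteq> ?N" using F CT by blast
    then have "bounded (F n)"
      using torus_cell_subset_cbox[of \<Lambda>] by (intro bounded_subset[OF bounded_cbox]) blast
    then have "compact (F n)" by (simp add: compact_eq_bounded_closed F(1))
    then have int: "0 \<le> (\<integral>x. v x * indicator (F n) x \<partial>?M)"
      using sub by (intro integral_compact_nonneg[OF \<open>0 < \<Lambda>\<close> v pos]) auto
    have [measurable]: "F n \<in> sets ?M"
      using F(1)[of n] sub by (auto simp: sets_restrict_space_iff borel_closed)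
    have integ: "integrable ?M (\<lambda>x. - (v x * indicator (F n) x))"
      by (intro Bochner_Integration.integrable_minus integrable_real_mult_indicator v) measurable
    \<comment> \<open>Since \<open>F n\<close> lies in the set where \<open>v\<close> is negative,
      this integrand is nonnegative. Its integral is also at most 0, hence it vanishes almost
      everywhere.\<close>
    have nonneg: "0 \<le> - (v x * indicator (F n) x)" for x
      using sub by (auto simp: indicator_def)
    have "0 \<le> (\<integral>x. - (v x * indicator (F n) x) \<partial>?M)"
      by (rule Bochner_Integration.integral_nonneg[OF nonneg])
    then have "(\<integral>x. - (v x * indicator (F n) x) \<partial>?M) = 0"
      using int by simp
    then have "AE x in ?M. - (v x * indicator (F n) x) = 0"
      by (simp only: integral_nonneg_eq_0_iff_AE[OF integ AE_I2[OF nonneg]])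
    then show ?thesis
      by eventually_elim (use sub in \<open>auto simp: indicator_def\<close>)
  qed
  then have "AE x in ?M. \<forall>n. x \<notin> F n" by (simp add: AE_all_countable)
  moreover have "AE x in ?M. x \<notin> T"
    using AE_not_in[OF CT(2)] by (simp add: AE_restrict_space_iff) (auto elim: eventually_mono)
  ultimately show ?thesis
  proof (rule AE_mp[OF AE_conjI], intro AE_I2 impI)
    fix x assume "x \<in> space ?M" "(\<forall>n. x \<notin> F n) \<and> x \<notin> T"
    then show "0 \<le> v x" using CT(3) F(2) by (auto simp: not_less[symmetric])
  qed
qed

section \<open>The L1 history average\<close>

lemma L1_weight_nonneg:
  assumes "\<alpha> < 1" shows "0 \<le> L1_weight \<alpha> k"
  unfolding L1_weight_def using assms by (simp add: powr_mono2)

text \<open>A weight is an increment of the power function over a unit interval. The mean value form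
  makes consecutive weights comparable through their intermediate points.\<close>

lemma L1_weight_mean_value:
  assumes "\<alpha> < 1"
  obtains \<xi> where "real k < \<xi>" "\<xi> < real k + 1" "L1_weight \<alpha> k = (1 - \<alpha>) * \<xi> powr - \<alpha>"
proof -
  \<comment> \<open>Continuity includes the left endpoint, also when it is 0, because the exponent
    is positive; the derivative is taken only to the right of \<open>real k\<close>.\<close>
  have "continuous_on {real k..real k + 1} (\<lambda>x. x powr (1 - \<alpha>))"
    using assms by (intro continuous_on_powr' continuous_intros) auto
  moreover have der: "((\<lambda>x. x powr (1 - \<alpha>)) has_real_derivative (1 - \<alpha>) * x powr - \<alpha>) (at x)"
    if "real k < x" for x
    using has_real_derivative_powr[of x "1 - \<alpha>"] that by simp
  moreover have "(\<lambda>x. x powr (1 - \<alpha>)) differentiable (at x)" if "real k < x" for x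
    using der[OF that] real_differentiable_def by blast
  ultimately obtain l \<xi> where \<xi>: "real k < \<xi>" "\<xi> < real k + 1"
    "((\<lambda>x. x powr (1 - \<alpha>)) has_real_derivative l) (at \<xi>)"
    "(real k + 1) powr (1 - \<alpha>) - real k powr (1 - \<alpha>) = (real k + 1 - real k) * l"
    using MVT[of "real k" "real k + 1" "\<lambda>x. x powr (1 - \<alpha>)"] by auto
  show ?thesis
    using that[OF \<xi>(1,2)] \<xi>(4) DERIV_unique[OF \<xi>(3) der[OF \<xi>(1)]] by (simp add: L1_weight_def)
qed

text \<open>The intermediate points lie in adjacent unit intervals, hence are ordered, and the power
  with exponent \<open>- \<alpha>\<close> is decreasing.\<close>

lemma L1_weight_decreasing:
  assumes "0 < \<alpha>" "\<alpha> < 1" shows "L1_weight \<alpha> (Suc k) \<le> L1_weight \<alpha> k"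
proof -
  obtain \<xi> where \<xi>: "real k < \<xi>" "\<xi> < real k + 1" "L1_weight \<alpha> k = (1 - \<alpha>) * \<xi> powr - \<alpha>"
    using L1_weight_mean_value[OF assms(2)] .
  obtain \<eta> where \<eta>: "real (Suc k) < \<eta>" "L1_weight \<alpha> (Suc k) = (1 - \<alpha>) * \<eta> powr - \<alpha>"
    using L1_weight_mean_value[OF assms(2)] .
  have "0 < \<xi>" using \<xi>(1) by linarith
  moreover have "\<xi> \<le> \<eta>" using \<xi>(2) \<eta>(1) by simp
  ultimately have "\<eta> powr - \<alpha> \<le> \<xi> powr - \<alpha>"
    using assms(1) by (intro powr_mono2') auto
  then show ?thesis
    using assms(2) by (simp add: \<xi>(3) \<eta>(2) mult_left_mono)
qed

text \<open>Every coefficient is nonnegative: the differences because the weights decrease, the last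
  one because the weights are nonnegative.\<close>

lemma L1_average_mono:
  assumes \<alpha>: "0 < \<alpha>" "\<alpha> < 1" and n: "1 \<le> n"
    and le: "\<And>k. k < n \<Longrightarrow> chi k x \<le> chi' k x"
  shows "L1_average \<alpha> chi n x \<le> L1_average \<alpha> chi' n x"
  unfolding L1_average_def
proof (intro add_mono sum_mono mult_left_mono)
  fix j assume j: "j \<in> {1..n - 1}"
  then show "0 \<le> L1_weight \<alpha> (j - 1) - L1_weight \<alpha> j"
    using L1_weight_decreasing[OF \<alpha>, of "j - 1"] by simp
  show "chi (n - j) x \<le> chi' (n - j) x" using j by (intro le) auto
qed (use n L1_weight_nonneg[OF \<alpha>(2)] le in auto)

text \<open>The differences telescope to the zeroth weight minus the last one, and the last one is
  added back; so the coefficients sum to the zeroth weight.\<close>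

lemma L1_average_const:
  assumes "1 \<le> n"
  shows "L1_average \<alpha> (\<lambda>k x. c) n x = c"
proof -
  have "(\<Sum>j = 1..m. L1_weight \<alpha> (j - 1) - L1_weight \<alpha> j) = L1_weight \<alpha> 0 - L1_weight \<alpha> m" for m
    by (induction m) simp_all
  \<comment> \<open>Uses the convention that \<open>0 powr\<close> any exponent is 0.\<close>
  moreover have "L1_weight \<alpha> 0 = 1" by (simp add: L1_weight_def)
  ultimately show ?thesis
    by (simp add: L1_average_def flip: sum_distrib_right) (simp add: algebra_simps)
qed

text \<open>Comparison with the constant histories 0 and 1.\<close>

lemma L1_average_bounds:
  assumes "0 < \<alpha>" "\<alpha> < 1" "1 \<le> n" "\<And>k. k < n \<Longrightarrow> chi k x \<in> {0, 1}"
  shows "0 \<le> L1_average \<alpha> chi n x" "L1_average \<alpha> chi n x \<le> 1"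
proof -
  have "L1_average \<alpha> (\<lambda>k x. 0) n x \<le> L1_average \<alpha> chi n x"
    by (rule L1_average_mono[OF assms(1-3)]) (use assms(4) in force)
  then show "0 \<le> L1_average \<alpha> chi n x" by (simp add: L1_average_const[OF assms(3)])
  have "L1_average \<alpha> chi n x \<le> L1_average \<alpha> (\<lambda>k x. 1) n x"
    by (rule L1_average_mono[OF assms(1-3)]) (use assms(4) in force)
  then show "L1_average \<alpha> chi n x \<le> 1" by (simp add: L1_average_const[OF assms(3)])
qed

lemma L1_average_AE_bounds:
  assumes "0 < \<alpha>" "\<alpha> < 1" "1 \<le> n" "\<And>k. k < n \<Longrightarrow> AE x in M. chi k x \<in> {0, 1}"
  shows "AE x in M. 0 \<le> L1_average \<alpha> chi n x \<and> L1_average \<alpha> chi n x \<le> 1"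
proof -
  have "AE x in M. \<forall>k\<in>{..<n}. chi k x \<in> {0, 1}"
    using assms(4) by (intro AE_finite_allI) auto
  then show ?thesis
  proof eventually_elim
    case (elim x)
    then show ?case using L1_average_bounds[OF assms(1-3), of chi x] by blast
  qed
qed

lemma L1_average_integrable:
  assumes "0 < \<alpha>" "\<alpha> < 1" "1 \<le> n" and chi: "\<And>k. k < n \<Longrightarrow> in_Linf_01 \<Lambda> (chi k)"
  shows "integrable (torus_measure \<Lambda>) (L1_average \<alpha> chi n)"
proof (rule integrable_torus_bounded)
  show "L1_average \<alpha> chi n \<in> borel_measurable (torus_measure \<Lambda>)"
    unfolding L1_average_def
    by (intro borel_measurable_add borel_measurable_sum borel_measurable_times borel_measurable_const)
      (use chi assms(3) in \<open>auto simp: in_Linf_01_def\<close>)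
  have "AE x in torus_measure \<Lambda>. 0 \<le> L1_average \<alpha> chi n x \<and> L1_average \<alpha> chi n x \<le> 1"
    using chi by (intro L1_average_AE_bounds assms(1-3)) (auto simp: in_Linf_01_def)
  then show "AE x in torus_measure \<Lambda>. \<bar>L1_average \<alpha> chi n x\<bar> \<le> 1"
    by eventually_elim auto
qed

section \<open>Order preservation\<close>

lemma nonneg_trig_poly_helmholtz_preimage:
  fixes \<psi> :: "real^'n \<Rightarrow> real"
  assumes "0 < \<Lambda>" "0 < c" "trig_poly \<Lambda> \<psi>" "\<And>x. 0 \<le> \<psi> x"
  shows "\<exists>\<phi>. trig_poly \<Lambda> \<phi> \<and> (\<forall>x. 0 \<le> \<phi> x) \<and>
    (\<forall>x. c * \<phi> x - (\<Sum>i\<in>UNIV. partial_deriv i (partial_deriv i \<phi>) x) = \<psi> x)"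
proof -
  obtain \<phi> where \<phi>: "trig_poly \<Lambda> \<phi>"
    and eq: "\<And>x. c * \<phi> x - (\<Sum>i\<in>UNIV. partial_deriv i (partial_deriv i \<phi>) x) = \<psi> x"
    using trig_poly_helmholtz_solvable[OF assms(3,2)] by blast
  have "0 \<le> \<phi> x" for x
    by (rule trig_poly_min_principle[OF assms(1,2) \<phi>]) (simp add: eq assms(4))
  with \<phi> eq show ?thesis by blast
qed

text \<open>The moment of \<open>w' - w\<close> against \<psi> is \<open>c\<close> times that of
  \<open>f' - f\<close> against the nonnegative preimage \<phi>. Integrability of the data makes the
  two data integrals comparable.\<close>

lemma helmholtz_comparison:
  fixes w w' :: "real^'n \<Rightarrow> real"
  assumes "0 < \<Lambda>" "0 < c" and sol: "helmholtz_weak_solution \<Lambda> c f w" "helmholtz_weak_solution \<Lambda> c f' w'"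
    and int: "integrable (torus_measure \<Lambda>) f" "integrable (torus_measure \<Lambda>) f'"
    and le: "AE x in torus_measure \<Lambda>. f x \<le> f' x"
  shows "AE x in torus_measure \<Lambda>. w x \<le> w' x"
proof -
  let ?M = "torus_measure \<Lambda> :: (real^'n) measure"
  have w: "integrable ?M w" "integrable ?M w'"
    using sol by (auto intro: in_L2_integrable helmholtz_weak_solution_in_L2)
  have "AE x in ?M. 0 \<le> w' x - w x"
  proof (rule AE_nonneg_if_trig_poly_moments_nonneg[OF \<open>0 < \<Lambda>\<close>])
    fix \<psi> :: "real^'n \<Rightarrow> real" assume \<psi>: "trig_poly \<Lambda> \<psi>" "\<And>x. 0 \<le> \<psi> x"
    obtain \<phi> where \<phi>: "trig_poly \<Lambda> \<phi>" "\<And>x. 0 \<le> \<phi> x"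
      and eq: "\<And>x. c * \<phi> x - (\<Sum>i\<in>UNIV. partial_deriv i (partial_deriv i \<phi>) x) = \<psi> x"
      using nonneg_trig_poly_helmholtz_preimage[OF assms(1,2) \<psi>] by blast
    have "(\<integral>x. f x * \<phi> x \<partial>?M) \<le> (\<integral>x. f' x * \<phi> x \<partial>?M)"
    proof (intro integral_mono_AE integrable_mult_trig_poly int \<phi>)
      show "AE x in ?M. f x * \<phi> x \<le> f' x * \<phi> x"
        using le by eventually_elim (simp add: mult_right_mono \<phi>(2))
    qed
    then have "(\<integral>x. w x * \<psi> x \<partial>?M) \<le> (\<integral>x. w' x * \<psi> x \<partial>?M)"
      using \<open>0 < c\<close> helmholtz_weak_solution_adjoint[OF \<open>0 < \<Lambda>\<close> sol(1) \<phi>(1) eq]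
        helmholtz_weak_solution_adjoint[OF \<open>0 < \<Lambda>\<close> sol(2) \<phi>(1) eq] by simp
    then show "0 \<le> (\<integral>x. (w' x - w x) * \<psi> x \<partial>?M)"
      using integrable_mult_trig_poly[OF w(1) \<psi>(1)] integrable_mult_trig_poly[OF w(2) \<psi>(1)]
      by (simp add: left_diff_distrib)
  qed (use w in simp)
  then show ?thesis by eventually_elim simp
qed

text \<open>Both bounds are moment inequalities: for the upper one, the integral of
  \<open>f x * \<phi> x\<close> is at most that of \<phi>, and \<open>c\<close> times the latter is
  the integral of \<psi>. The sign criterion is then applied to \<open>w\<close> and to
  \<open>1 - w\<close>.\<close>

lemma helmholtz_bounds:
  fixes w :: "real^'n \<Rightarrow> real"
  assumes "0 < \<Lambda>" "0 < c" and sol: "helmholtz_weak_solution \<Lambda> c f w"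
    and f: "AE x in torus_measure \<Lambda>. 0 \<le> f x \<and> f x \<le> 1"
  shows "AE x in torus_measure \<Lambda>. 0 \<le> w x \<and> w x \<le> 1"
proof -
  let ?M = "torus_measure \<Lambda> :: (real^'n) measure"
  have w: "integrable ?M w"
    using sol by (intro in_L2_integrable helmholtz_weak_solution_in_L2)
  have "0 \<le> (\<integral>x. w x * \<psi> x \<partial>?M) \<and> (\<integral>x. w x * \<psi> x \<partial>?M) \<le> (\<integral>x. \<psi> x \<partial>?M)"
    if \<psi>: "trig_poly \<Lambda> \<psi>" "\<And>x. 0 \<le> \<psi> x" for \<psi>
  proof -
    obtain \<phi> where \<phi>: "trig_poly \<Lambda> \<phi>" "\<And>x. 0 \<le> \<phi> x"
      and eq: "\<And>x. c * \<phi> x - (\<Sum>i\<in>UNIV. partial_deriv i (partial_deriv i \<phi>) x) = \<psi> x"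
      using nonneg_trig_poly_helmholtz_preimage[OF assms(1,2) \<psi>] by blast
    have int: "integrable ?M \<phi>" by (rule integrable_torus_continuous[OF trig_poly_continuous_on[OF \<phi>(1)]])
    have "0 \<le> (\<integral>x. f x * \<phi> x \<partial>?M)"
      by (rule integral_nonneg_AE) (use f in eventually_elim, simp add: \<phi>(2))
    \<comment> \<open>Here \<open>f\<close> is known only through its bounds almost everywhere. If
      \<open>f x * \<phi> x\<close> were not integrable, its integral would be 0 by convention, and
      the estimate would still hold because \<phi> is nonnegative.\<close>
    moreover have "(\<integral>x. f x * \<phi> x \<partial>?M) \<le> (\<integral>x. \<phi> x \<partial>?M)"
      by (rule integral_mono_AE'[OF int]) (use f in eventually_elim, simp_all add: \<phi>(2) mult_left_le_one_le)
    ultimately show ?thesis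
      using \<open>0 < c\<close> helmholtz_weak_solution_adjoint[OF \<open>0 < \<Lambda>\<close> sol \<phi>(1) eq]
        integral_trig_poly_adjoint[OF \<open>0 < \<Lambda>\<close> \<phi>(1) eq] by simp
  qed
  note moments = this
  have int1: "integrable ?M (\<lambda>x. 1)"
    by (rule finite_measure.integrable_const[OF finite_torus_measure])
  have "AE x in ?M. 0 \<le> w x"
    using moments by (intro AE_nonneg_if_trig_poly_moments_nonneg[OF \<open>0 < \<Lambda>\<close> w]) blast
  moreover have "AE x in ?M. 0 \<le> 1 - w x"
  proof (rule AE_nonneg_if_trig_poly_moments_nonneg[OF \<open>0 < \<Lambda>\<close>])
    show "integrable ?M (\<lambda>x. 1 - w x)" using int1 w by (rule Bochner_Integration.integrable_diff)
    fix \<psi> :: "real^'n \<Rightarrow> real" assume \<psi>: "trig_poly \<Lambda> \<psi>" "\<And>x. 0 \<le> \<psi> x"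
    then show "0 \<le> (\<integral>x. (1 - w x) * \<psi> x \<partial>?M)"
      using moments[OF \<psi>] integrable_mult_trig_poly[OF w \<psi>(1)] integrable_mult_trig_poly[OF int1 \<psi>(1)]
      by (simp add: left_diff_distrib)
  qed
  ultimately show ?thesis by eventually_elim simp
qed

section \<open>Application to the scheme\<close>

lemma threshold_scheme_phase:
  assumes "threshold_scheme \<alpha> h \<Lambda> chi w"
  shows "AE x in torus_measure \<Lambda>. chi k x \<in> {0, 1}"
proof (cases "k = 0")
  case True
  then show ?thesis using assms by (simp add: threshold_scheme_def in_Linf_01_def)
next
  case False
  then have "AE x in torus_measure \<Lambda>. chi k x = threshold (w k) x"
    using assms by (simp add: threshold_scheme_def)
  then show ?thesis by eventually_elim (simp add: threshold_def indicator_def)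
qed

lemma diffusion_coefficient_pos:
  fixes \<alpha> h :: real
  assumes "\<alpha> < 1" "0 < h" shows "0 < 1 / (Gamma (2 - \<alpha>) * h powr \<alpha>)"
  using assms by (intro divide_pos_pos mult_pos_pos Gamma_real_pos) auto

theorem proposition3p3:
  fixes \<alpha> h \<Lambda> :: real
  assumes "0 < \<alpha>" and "\<alpha> < 1" and "0 < h" and "0 < \<Lambda>"
  shows
    "(\<forall>chi w :: nat \<Rightarrow> real^'n \<Rightarrow> real. threshold_scheme \<alpha> h \<Lambda> chi w \<longrightarrow>
       (\<forall>n\<ge>1. AE x in torus_measure \<Lambda>.
          0 \<le> L1_average \<alpha> chi n x \<and> L1_average \<alpha> chi n x \<le> 1 \<and> 0 \<le> w n x \<and> w n x \<le> 1))
     \<and>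
     (\<forall>n\<ge>1. \<forall>chi chi' :: nat \<Rightarrow> real^'n \<Rightarrow> real. \<forall>w w' :: real^'n \<Rightarrow> real.
       (\<forall>k<n. in_Linf_01 \<Lambda> (chi k) \<and> in_Linf_01 \<Lambda> (chi' k) \<and>
              (AE x in torus_measure \<Lambda>. chi k x \<le> chi' k x)) \<and>
       diffusion_step \<alpha> h \<Lambda> chi n w \<and> diffusion_step \<alpha> h \<Lambda> chi' n w' \<longrightarrow>
       (AE x in torus_measure \<Lambda>. L1_average \<alpha> chi n x \<le> L1_average \<alpha> chi' n x) \<and>
       (AE x in torus_measure \<Lambda>. w x \<le> w' x) \<and>
       (AE x in torus_measure \<Lambda>. threshold w x \<le> threshold w' x))"
proof (intro conjI allI impI)
  fix chi w :: "nat \<Rightarrow> real^'n \<Rightarrow> real" and n :: nat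
  assume scheme: "threshold_scheme \<alpha> h \<Lambda> chi w" and n: "1 \<le> n"
  have avg: "AE x in torus_measure \<Lambda>. 0 \<le> L1_average \<alpha> chi n x \<and> L1_average \<alpha> chi n x \<le> 1"
    by (rule L1_average_AE_bounds[OF assms(1,2) n threshold_scheme_phase[OF scheme]])
  have "helmholtz_weak_solution \<Lambda> (1 / (Gamma (2 - \<alpha>) * h powr \<alpha>)) (L1_average \<alpha> chi n) (w n)"
    using scheme n by (simp add: threshold_scheme_def diffusion_step_def)
  from helmholtz_bounds[OF assms(4) diffusion_coefficient_pos[OF assms(2,3)] this avg] avg
  show "AE x in torus_measure \<Lambda>. 0 \<le> L1_average \<alpha> chi n x \<and> L1_average \<alpha> chi n x \<le> 1 \<and>
      0 \<le> w n x \<and> w n x \<le> 1"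
    by eventually_elim simp
next
  fix n :: nat and chi chi' :: "nat \<Rightarrow> real^'n \<Rightarrow> real" and w w' :: "real^'n \<Rightarrow> real"
  assume n: "1 \<le> n" and *: "(\<forall>k<n. in_Linf_01 \<Lambda> (chi k) \<and> in_Linf_01 \<Lambda> (chi' k) \<and>
      (AE x in torus_measure \<Lambda>. chi k x \<le> chi' k x)) \<and>
    diffusion_step \<alpha> h \<Lambda> chi n w \<and> diffusion_step \<alpha> h \<Lambda> chi' n w'"
  have "AE x in torus_measure \<Lambda>. \<forall>k\<in>{..<n}. chi k x \<le> chi' k x"
    using * by (intro AE_finite_allI) auto
  then show avg: "AE x in torus_measure \<Lambda>. L1_average \<alpha> chi n x \<le> L1_average \<alpha> chi' n x"
    by eventually_elim (auto intro: L1_average_mono[OF assms(1,2) n])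
  have sol: "helmholtz_weak_solution \<Lambda> (1 / (Gamma (2 - \<alpha>) * h powr \<alpha>)) (L1_average \<alpha> chi n) w"
    "helmholtz_weak_solution \<Lambda> (1 / (Gamma (2 - \<alpha>) * h powr \<alpha>)) (L1_average \<alpha> chi' n) w'"
    using * by (simp_all add: diffusion_step_def)
  have int: "integrable (torus_measure \<Lambda>) (L1_average \<alpha> chi n)"
    "integrable (torus_measure \<Lambda>) (L1_average \<alpha> chi' n)"
    using * by (intro L1_average_integrable[OF assms(1,2) n]; simp)+
  show w: "AE x in torus_measure \<Lambda>. w x \<le> w' x"
    by (rule helmholtz_comparison[OF assms(4) diffusion_coefficient_pos[OF assms(2,3)] sol int avg])
  then show "AE x in torus_measure \<Lambda>. threshold w x \<le> threshold w' x"
    by eventually_elim (simp add: threshold_def indicator_def)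
qed

end
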